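(* Let $V$ be a real vector space of finite dimension $n$ with a positive definite inner product $\langle\cdot,\cdot\rangle$. If $\varphi$ is a symmetric bilinear form on $V$, then there exist an orthonormal basis $\{f_1, \ldots, f_n\}$ of $V$ and real numbers $\lambda_1,\ldots,\lambda_n$ such that $\varphi(f_i, f_j) = \lambda_i \delta_{ij}$ for all $i, j$.
   Context: $\delta_{ij}$ is the Kronecker delta. *)

theory Defs
  imports "HOL-Analysis.Analysis"
begin

text \<open>
  Inner product spaces are types of class \<open>real_inner\<close>, which carry a symmetric positive
  definite form but no dimension restriction. The class \<open>euclidean_space\<close> would exclude the
  zero space. Finiteness has to be stated separately from the value of \<open>dim\<close>, because \<open>dim\<close>
  is 0 on infinite-dimensional spaces.
\<close>

definition has_finite_dim :: "'a::real_vector itself \<Rightarrow> nat \<Rightarrow> bool" where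
  "has_finite_dim _ n \<longleftrightarrow> (\<exists>B :: 'a set. finite B \<and> span B = UNIV) \<and> dim (UNIV :: 'a set) = n"

definition symmetric_bilinear :: "('a::real_vector \<Rightarrow> 'a \<Rightarrow> real) \<Rightarrow> bool" where
  "symmetric_bilinear \<phi> \<longleftrightarrow> bilinear \<phi> \<and> (\<forall>x y. \<phi> x y = \<phi> y x)"

definition kronecker_delta :: "nat \<Rightarrow> nat \<Rightarrow> real" where
  "kronecker_delta i j = (if i = j then 1 else 0)"

text \<open>Bases are families indexed by \<open>{1..n}\<close>; values outside that range are irrelevant.\<close>

definition orthonormal_basis :: "nat \<Rightarrow> (nat \<Rightarrow> 'a::real_inner) \<Rightarrow> bool" where
  "orthonormal_basis n f \<longleftrightarrow>
     inj_on f {1..n} \<and> independent (f ` {1..n}) \<and> span (f ` {1..n}) = UNIV \<and>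
     (\<forall>i\<in>{1..n}. \<forall>j\<in>{1..n}. f i \<bullet> f j = kronecker_delta i j)"

end

theory Submission
  imports Defs
begin

text \<open>
  A unit vector maximising \<open>\<phi> x x\<close> among the unit vectors orthogonal to given eigenvectors is again
  an eigenvector, in the sense that \<open>\<phi> v x = \<phi> v v * (v \<bullet> x)\<close> for all \<open>x\<close>. The maximum exists
  because the unit sphere is compact in finite dimension. Hence a maximal orthonormal set of
  eigenvectors spans the space.
\<close>

definition eigen_orthonormal :: "('a::real_inner \<Rightarrow> 'a \<Rightarrow> real) \<Rightarrow> 'a set \<Rightarrow> bool" where
  "eigen_orthonormal \<phi> F \<longleftrightarrow> finite F \<and> pairwise orthogonal F \<and>
     (\<forall>v\<in>F. norm v = 1 \<and> (\<forall>x. \<phi> v x = \<phi> v v * (v \<bullet> x)))"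

lemma eigen_orthonormalD:
  assumes "eigen_orthonormal \<phi> F"
  shows "finite F" "pairwise orthogonal F" "\<And>v. v \<in> F \<Longrightarrow> norm v = 1"
    "\<And>v x. v \<in> F \<Longrightarrow> \<phi> v x = \<phi> v v * (v \<bullet> x)"
  using assms unfolding eigen_orthonormal_def by blast+

section \<open>Orthonormal expansions and projections\<close>

text \<open>Pairing any representation of \<open>x\<close> with \<open>c\<close> in \<open>B\<close>
  kills every term but the one at \<open>c\<close>, so the coefficient there can only be
  \<open>x \<bullet> c\<close>.\<close>

lemma orthonormal_expansion:
  fixes B :: "'a::real_inner set"
  assumes "finite B" "pairwise orthogonal B" "\<And>b. b \<in> B \<Longrightarrow> norm b = 1" "x \<in> span B"
  shows "x = (\<Sum>b\<in>B. (x \<bullet> b) *\<^sub>R b)"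
proof -
  obtain u where u: "x = (\<Sum>b\<in>B. u b *\<^sub>R b)"
    using assms(1,4) by (auto simp: span_finite)
  have "x \<bullet> c = u c" if c: "c \<in> B" for c
  proof -
    have "x \<bullet> c = (\<Sum>b\<in>B. u b * (b \<bullet> c))"
      by (simp add: u inner_sum_left)
    also have "\<dots> = (\<Sum>b\<in>B. if b = c then u c else 0)"
      using assms(2,3) c
      by (intro sum.cong) (auto simp: pairwise_def orthogonal_def dot_square_norm)
    finally show ?thesis using assms(1) c by simp
  qed
  then show ?thesis using u by simp
qed

text \<open>The sum is the orthogonal projection of \<open>x\<close> onto \<open>span B\<close>.
  Here \<open>x\<close> may lie outside that span, which is how new vectors orthogonal to
  \<open>B\<close> are produced later.\<close>

lemma residual_orthogonal:
  fixes B :: "'a::real_inner set"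
  assumes "finite B" "pairwise orthogonal B" "\<And>b. b \<in> B \<Longrightarrow> norm b = 1" "c \<in> B"
  shows "(x - (\<Sum>b\<in>B. (x \<bullet> b) *\<^sub>R b)) \<bullet> c = 0"
proof -
  have "(\<Sum>b\<in>B. (x \<bullet> b) *\<^sub>R b) \<bullet> c = (\<Sum>b\<in>B. (x \<bullet> b) * (b \<bullet> c))"
    by (simp add: inner_sum_left)
  also have "\<dots> = (\<Sum>b\<in>B. if b = c then x \<bullet> c else 0)"
    using assms(2-4)
    by (intro sum.cong) (auto simp: pairwise_def orthogonal_def dot_square_norm)
  finally show ?thesis using assms(1,4) by (simp add: inner_diff_left)
qed

text \<open>Gram-Schmidt may leave the zero vector in \<open>C\<close>. Dropping it and rescaling
  the other vectors to length 1 preserves the span.\<close>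

lemma orthonormal_spanning_set_exists:
  fixes A :: "'a::real_inner set"
  assumes "finite A"
  obtains B where "finite B" "pairwise orthogonal B" "\<And>b. b \<in> B \<Longrightarrow> norm b = 1"
    "span B = span A"
proof -
  obtain C where C: "finite C" "span C = span A" "pairwise orthogonal C"
    using basis_orthogonal[OF assms] by blast
  let ?n = "\<lambda>x::'a. x /\<^sub>R norm x"
  let ?B = "?n ` (C - {0})"
  show ?thesis
  proof (rule that)
    show "finite ?B" using C(1) by simp
    show "pairwise orthogonal ?B"
      using C(3) by (auto simp: pairwise_def orthogonal_def)
    show "norm b = 1" if "b \<in> ?B" for b
      using that by (auto intro!: left_inverse)
    have "span ?B = span (C - {0})"
      by (rule span_image_scale) (use C in auto)
    also have "\<dots> = span A" using C(2) by simp
    finally show "span ?B = span A" .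
  qed
qed

section \<open>Compactness and continuity in finite dimension\<close>

text \<open>Each new vector \<open>c\<close> adds, as a Minkowski sum, the compact segment from
  \<open>-c\<close> to \<open>c\<close>, and sums of compact sets are compact.\<close>

lemma compact_box_sum:
  fixes B :: "'a::real_normed_vector set"
  assumes "finite B"
  shows "compact {\<Sum>b\<in>B. u b *\<^sub>R b |u. \<forall>b\<in>B. \<bar>u b\<bar> \<le> 1}" (is "compact (?K B)")
  using assms
proof (induction B)
  case empty
  then show ?case by simp
next
  case (insert c B)
  let ?I = "(\<lambda>t. t *\<^sub>R c) ` {-1..1::real}"
  have "compact ?I"
    by (intro compact_continuous_image continuous_intros) auto
  then have "compact {x + y |x y. x \<in> ?I \<and> y \<in> ?K B}"
    using compact_sums[of ?I "?K B"] insert.IH by blast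
  moreover have "{x + y |x y. x \<in> ?I \<and> y \<in> ?K B} = ?K (insert c B)" (is "?L = ?R")
  proof
    show "?L \<subseteq> ?R"
    proof clarify
      fix t :: real and u :: "'a \<Rightarrow> real"
      assume t: "t \<in> {-1..1}" and u: "\<forall>b\<in>B. \<bar>u b\<bar> \<le> 1"
      \<comment> \<open>As \<open>c\<close> is not in \<open>B\<close>, its coefficient can be
        overwritten without touching the old sum.\<close>
      have "(\<Sum>b\<in>B. (u(c := t)) b *\<^sub>R b) = (\<Sum>b\<in>B. u b *\<^sub>R b)"
        by (intro sum.cong) (use insert.hyps in auto)
      then have "t *\<^sub>R c + (\<Sum>b\<in>B. u b *\<^sub>R b) = (\<Sum>b\<in>insert c B. (u(c := t)) b *\<^sub>R b)"
        using insert.hyps by simp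
      then show "\<exists>v. t *\<^sub>R c + (\<Sum>b\<in>B. u b *\<^sub>R b) = (\<Sum>b\<in>insert c B. v b *\<^sub>R b) \<and>
          (\<forall>b\<in>insert c B. \<bar>v b\<bar> \<le> 1)"
        using t u by (intro exI[of _ "u(c := t)"]) auto
    qed
    show "?R \<subseteq> ?L"
    proof clarify
      fix u :: "'a \<Rightarrow> real"
      assume u: "\<forall>b\<in>insert c B. \<bar>u b\<bar> \<le> 1"
      have "u c *\<^sub>R c \<in> ?I" using u by (intro imageI) auto
      moreover have "(\<Sum>b\<in>insert c B. u b *\<^sub>R b) = u c *\<^sub>R c + (\<Sum>b\<in>B. u b *\<^sub>R b)"
        using insert.hyps by simp
      ultimately show "\<exists>x y. (\<Sum>b\<in>insert c B. u b *\<^sub>R b) = x + y \<and> x \<in> ?I \<and> y \<in> ?K B"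
        using u by blast
    qed
  qed
  ultimately show ?case by simp
qed

text \<open>By Cauchy-Schwarz the orthonormal coordinates of a unit vector lie in [-1, 1], so the
  sphere is a closed subset of a compact box.\<close>

lemma compact_unit_sphere:
  fixes A :: "'a::real_inner set"
  assumes "finite A" "span A = UNIV"
  shows "compact {x::'a. norm x = 1}"
proof -
  obtain B where B: "finite B" "pairwise orthogonal B" "\<And>b::'a. b \<in> B \<Longrightarrow> norm b = 1"
    "span B = UNIV"
    using orthonormal_spanning_set_exists[OF assms(1)] assms(2) by metis
  let ?K = "{\<Sum>b\<in>B. u b *\<^sub>R b |u. \<forall>b\<in>B. \<bar>u b\<bar> \<le> 1}"
  have "x \<in> ?K" if x: "norm x = 1" for x :: 'a
  proof -
    have "\<bar>x \<bullet> b\<bar> \<le> 1" if "b \<in> B" for b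
      using Cauchy_Schwarz_ineq2[of x b] x B(3)[OF that] by simp
    moreover have "x = (\<Sum>b\<in>B. (x \<bullet> b) *\<^sub>R b)"
      using orthonormal_expansion[of B x] B by simp
    ultimately show ?thesis by blast
  qed
  then have "?K \<inter> {x. norm x = 1} = {x. norm x = 1}" by auto
  moreover have "closed {x::'a. norm x = 1}"
    by (intro closed_Collect_eq continuous_intros)
  then have "compact (?K \<inter> {x. norm x = 1})"
    by (rule compact_Int_closed[OF compact_box_sum[OF B(1)]])
  ultimately show ?thesis by (simp only:)
qed

text \<open>In orthonormal coordinates the form is a quadratic polynomial in the continuous
  functions \<open>x \<bullet> b\<close>.\<close>

lemma continuous_on_quadratic_form:
  fixes \<phi> :: "'a::real_inner \<Rightarrow> 'a \<Rightarrow> real"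
  assumes "finite A" "span A = (UNIV :: 'a set)" "bilinear \<phi>"
  shows "continuous_on S (\<lambda>x. \<phi> x x)"
proof -
  obtain B where B: "finite B" "pairwise orthogonal B" "\<And>b::'a. b \<in> B \<Longrightarrow> norm b = 1"
    "span B = UNIV"
    using orthonormal_spanning_set_exists[OF assms(1)] assms(2) by metis
  have "\<phi> x x = (\<Sum>(b, c)\<in>B \<times> B. (x \<bullet> b) * (x \<bullet> c) * \<phi> b c)" for x
  proof -
    have x: "x = (\<Sum>b\<in>B. (x \<bullet> b) *\<^sub>R b)"
      using orthonormal_expansion[of B x] B by simp
    have "\<phi> x x = \<phi> (\<Sum>b\<in>B. (x \<bullet> b) *\<^sub>R b) (\<Sum>b\<in>B. (x \<bullet> b) *\<^sub>R b)"
      using x by simp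
    also have "\<dots> = (\<Sum>(b, c)\<in>B \<times> B. \<phi> ((x \<bullet> b) *\<^sub>R b) ((x \<bullet> c) *\<^sub>R c))"
      by (rule bilinear_sum[OF assms(3)])
    finally show ?thesis
      by (simp add: bilinear_lmul[OF assms(3)] bilinear_rmul[OF assms(3)] ac_simps)
  qed
  then show ?thesis
    by (simp add: case_prod_unfold) (intro continuous_intros)
qed

section \<open>Constrained maximisation yields a new eigenvector\<close>

text \<open>For small \<open>t\<close> with the sign of \<open>a\<close>, a nonzero linear term
  would outweigh the quadratic one and make the expression negative.\<close>

lemma perturbation_zero:
  fixes a h :: real
  assumes "\<And>t. 0 \<le> t\<^sup>2 * h - 2 * t * a" "0 \<le> h"
  shows "a = 0"
proof (rule ccontr)
  assume "a \<noteq> 0"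
  \<comment> \<open>Dividing by \<open>h + 1\<close> rather than \<open>h\<close> also covers
    \<open>h = 0\<close>.\<close>
  define t where "t = a / (h + 1)"
  have a: "a = t * (h + 1)" and "t \<noteq> 0"
    using \<open>a \<noteq> 0\<close> assms(2) by (auto simp: t_def)
  have "t\<^sup>2 * h - 2 * t * a = - (t\<^sup>2 * (h + 2))"
    by (simp add: a power2_eq_square algebra_simps)
  also have "\<dots> < 0" using \<open>t \<noteq> 0\<close> assms(2) by simp
  finally show False using assms(1)[of t] by simp
qed

text \<open>Maximality of \<open>v\<close> on the unit sphere of the orthogonal complement
  \<open>W\<close> of \<open>F\<close> gives \<open>\<phi> v w = 0\<close> for \<open>w\<close> in
  \<open>W\<close> orthogonal to \<open>v\<close>. Symmetry of \<open>\<phi>\<close> gives the same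
  for \<open>w\<close> in \<open>F\<close>. Only the component of a vector along \<open>v\<close>
  then contributes.\<close>

lemma eigen_orthonormal_extend:
  fixes \<phi> :: "'a::real_inner \<Rightarrow> 'a \<Rightarrow> real"
  assumes "finite A" "span A = (UNIV :: 'a set)"
    and bil: "bilinear \<phi>" and sym: "\<And>x y. \<phi> x y = \<phi> y x"
    and F: "eigen_orthonormal \<phi> F" and "span F \<noteq> UNIV"
  obtains v where "v \<notin> F" "eigen_orthonormal \<phi> (insert v F)"
proof -
  note bilinear_simps = bilinear_ladd[OF bil] bilinear_radd[OF bil] bilinear_lmul[OF bil]
    bilinear_rmul[OF bil]
  note fin = eigen_orthonormalD(1)[OF F] and orth = eigen_orthonormalD(2)[OF F]
    and unit = eigen_orthonormalD(3)[OF F] and eig = eigen_orthonormalD(4)[OF F]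
  define W where "W = {x. \<forall>f\<in>F. x \<bullet> f = 0}"
  have W_add: "x + y \<in> W" if "x \<in> W" "y \<in> W" for x y
    using that by (simp add: W_def inner_add_left)
  have W_scale: "t *\<^sub>R x \<in> W" if "x \<in> W" for t x
    using that by (simp add: W_def)
  define C where "C = {x. norm x = 1} \<inter> W"
  have "W = (\<Inter>f\<in>F. {x. x \<bullet> f = 0})" by (auto simp: W_def)
  moreover have "closed (\<Inter>f\<in>F. {x. x \<bullet> f = 0})"
    by (intro closed_INT ballI closed_Collect_eq continuous_intros)
  ultimately have "compact C"
    unfolding C_def using compact_unit_sphere[OF assms(1,2)] by (metis compact_Int_closed)
  moreover have "C \<noteq> {}"
  proof -
    \<comment> \<open>A vector outside \<open>span F\<close> has a nonzero residual after
      projection; normalised, it is a point of \<open>C\<close>.\<close>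
    obtain x where x: "x \<notin> span F" using assms(6) by auto
    define y where "y = x - (\<Sum>f\<in>F. (x \<bullet> f) *\<^sub>R f)"
    have "y \<in> W"
      unfolding W_def y_def using residual_orthogonal[OF fin orth unit] by blast
    have "(\<Sum>f\<in>F. (x \<bullet> f) *\<^sub>R f) \<in> span F"
      by (intro span_sum span_scale span_base)
    then have "y \<noteq> 0" using x by (auto simp: y_def)
    then have "y /\<^sub>R norm y \<in> C"
      using W_scale[OF \<open>y \<in> W\<close>] by (simp add: C_def)
    then show ?thesis by blast
  qed
  ultimately have "\<exists>v\<in>C. \<forall>x\<in>C. \<phi> x x \<le> \<phi> v v"
    by (rule continuous_attains_sup) (rule continuous_on_quadratic_form[OF assms(1-3)])
  then obtain v where v: "v \<in> C" "\<And>x. x \<in> C \<Longrightarrow> \<phi> x x \<le> \<phi> v v"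
    by blast
  have vW: "v \<in> W" and nv: "norm v = 1" using v(1) by (auto simp: C_def)
  have vv: "v \<bullet> v = 1" using nv by (simp add: dot_square_norm)
  \<comment> \<open>Being homogeneous of degree 2, \<open>g\<close> turns the maximum over unit
    vectors into nonnegativity on all of \<open>W\<close>, with value 0 at \<open>v\<close>.\<close>
  define g where "g x = \<phi> v v * (x \<bullet> x) - \<phi> x x" for x
  have g_nonneg: "0 \<le> g x" if "x \<in> W" for x
  proof (cases "x = 0")
    case True
    then show ?thesis by (simp add: g_def bilinear_lzero[OF bil])
  next
    case False
    have "x /\<^sub>R norm x \<in> C" using W_scale[OF that] False by (simp add: C_def)
    then have "\<phi> (x /\<^sub>R norm x) (x /\<^sub>R norm x) \<le> \<phi> v v" by (rule v(2))
    then have "\<phi> x x / (norm x)\<^sup>2 \<le> \<phi> v v"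
      by (simp add: bilinear_simps power2_eq_square field_simps)
    then show ?thesis using False
      by (simp add: g_def dot_square_norm field_simps)
  qed
  \<comment> \<open>First-order condition: \<open>g\<close> is minimal on \<open>W\<close> at
    \<open>v\<close>, and its derivative there in direction \<open>w\<close> is
    \<open>-2 * \<phi> v w\<close>.\<close>
  have zero: "\<phi> v w = 0" if w: "w \<in> W" "v \<bullet> w = 0" for w
  proof (rule perturbation_zero)
    show "0 \<le> g w" by (rule g_nonneg[OF w(1)])
    fix t
    have "g (v + t *\<^sub>R w) = t\<^sup>2 * g w - 2 * t * \<phi> v w"
      using w(2) vv sym[of w v]
      by (simp add: g_def bilinear_simps inner_add_left inner_add_right inner_commute[of w v]
          power2_eq_square algebra_simps)
    then show "0 \<le> t\<^sup>2 * g w - 2 * t * \<phi> v w"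
      using g_nonneg[OF W_add[OF vW W_scale[OF w(1)]]] by metis
  qed
  have vF: "v \<bullet> f = 0" "f \<bullet> v = 0" if "f \<in> F" for f
    using vW that by (auto simp: W_def inner_commute)
  then have "v \<notin> F" using vv by fastforce
  let ?G = "insert v F"
  have orthG: "pairwise orthogonal ?G"
    using orth vF by (auto simp: pairwise_insert orthogonal_def)
  have unitG: "\<And>b. b \<in> ?G \<Longrightarrow> norm b = 1" using unit nv by auto
  have "\<phi> v x = \<phi> v v * (v \<bullet> x)" for x
  proof -
    \<comment> \<open>This residual is orthogonal both to \<open>F\<close> and to \<open>v\<close>,
      as \<open>zero\<close> requires.\<close>
    define w where "w = x - (\<Sum>b\<in>?G. (x \<bullet> b) *\<^sub>R b)"
    have w: "w \<bullet> b = 0" if "b \<in> ?G" for b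
      unfolding w_def using residual_orthogonal[of ?G b x] orthG unitG that fin by auto
    then have "\<phi> v w = 0" by (intro zero) (auto simp: W_def inner_commute)
    have lin: "linear (\<phi> v)" using bil by (simp add: bilinear_def)
    \<comment> \<open>Symmetry moves \<open>f\<close> into the first argument, where its eigenvector
      equation applies.\<close>
    have "\<phi> v f = 0" if "f \<in> F" for f
      using eig[OF that, of v] vF[OF that] sym[of v f] by simp
    then have sum0: "\<phi> v (\<Sum>b\<in>F. (x \<bullet> b) *\<^sub>R b) = 0"
      by (simp add: linear_sum[OF lin] bilinear_rmul[OF bil])
    have x: "x = w + ((x \<bullet> v) *\<^sub>R v + (\<Sum>b\<in>F. (x \<bullet> b) *\<^sub>R b))"
      using fin \<open>v \<notin> F\<close> by (simp add: w_def)
    have "\<phi> v x = (x \<bullet> v) * \<phi> v v"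
      by (subst x) (simp only: bilinear_simps sum0 \<open>\<phi> v w = 0\<close> add_0 add_0_right
          real_scaleR_def)
    then show ?thesis by (simp add: inner_commute)
  qed
  then have "eigen_orthonormal \<phi> ?G"
    using F orthG nv unfolding eigen_orthonormal_def by blast
  with \<open>v \<notin> F\<close> show ?thesis by (rule that)
qed

section \<open>Maximal eigenvector sets and the indexed basis\<close>

lemma eigen_orthonormal_independent:
  assumes "eigen_orthonormal \<phi> F"
  shows "independent F"
proof (rule pairwise_orthogonal_independent)
  show "0 \<notin> F" using eigen_orthonormalD(3)[OF assms, of 0] by auto
qed (rule eigen_orthonormalD(2)[OF assms])

text \<open>Independence bounds the size of such sets by \<open>card A\<close>, so one of largest
  cardinality exists; if it did not span, it could be extended.\<close>

lemma eigen_orthonormal_spanning_exists: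
  fixes \<phi> :: "'a::real_inner \<Rightarrow> 'a \<Rightarrow> real"
  assumes A: "finite A" "span A = (UNIV :: 'a set)"
    and bil: "bilinear \<phi>" and sym: "\<And>x y. \<phi> x y = \<phi> y x"
  obtains F where "eigen_orthonormal \<phi> F" "span F = UNIV"
proof -
  have "card F \<le> card A" if "eigen_orthonormal \<phi> F" for F
    using independent_span_bound[OF A(1) eigen_orthonormal_independent[OF that]] A(2) by simp
  then have bound: "\<forall>F. eigen_orthonormal \<phi> F \<longrightarrow> card F < Suc (card A)"
    by (simp add: le_imp_less_Suc)
  \<comment> \<open>The empty set starts the search, and is itself the answer in the zero
    space.\<close>
  have "eigen_orthonormal \<phi> {}" by (simp add: eigen_orthonormal_def)
  then obtain F where F: "eigen_orthonormal \<phi> F"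
    "\<And>G. eigen_orthonormal \<phi> G \<Longrightarrow> card G \<le> card F"
    using ex_has_greatest_nat[OF _ bound] by blast
  have "span F = UNIV"
  proof (rule ccontr)
    assume "span F \<noteq> UNIV"
    then obtain v where "v \<notin> F" "eigen_orthonormal \<phi> (insert v F)"
      using eigen_orthonormal_extend[OF A bil sym F(1)] by blast
    then show False
      using eigen_orthonormalD(1)[OF F(1)] F(2)[of "insert v F"] by simp
  qed
  with F(1) show ?thesis by (rule that)
qed

theorem theorem1p2:
  fixes \<phi> :: "'a::real_inner \<Rightarrow> 'a \<Rightarrow> real" and n :: nat
  assumes "has_finite_dim TYPE('a) n"
    and "symmetric_bilinear \<phi>"
  shows "\<exists>(f :: nat \<Rightarrow> 'a) (l :: nat \<Rightarrow> real).
           orthonormal_basis n f \<and>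
           (\<forall>i\<in>{1..n}. \<forall>j\<in>{1..n}. \<phi> (f i) (f j) = l i * kronecker_delta i j)"
proof -
  obtain A :: "'a set" where A: "finite A" "span A = UNIV" and n: "dim (UNIV :: 'a set) = n"
    using assms(1) by (auto simp: has_finite_dim_def)
  have bil: "bilinear \<phi>" and sym: "\<And>x y. \<phi> x y = \<phi> y x"
    using assms(2) by (auto simp: symmetric_bilinear_def)
  obtain F where F: "eigen_orthonormal \<phi> F" "span F = UNIV"
    using eigen_orthonormal_spanning_exists[OF A bil sym] by blast
  note ind = eigen_orthonormal_independent[OF F(1)]
  have "card F = n" using dim_eq_card[OF _ ind, of UNIV] F(2) n by simp
  moreover have "finite F" by (rule eigen_orthonormalD(1)[OF F(1)])
  ultimately obtain f where f: "bij_betw f {1..n} F"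
    using ex_bij_betw_nat_finite_1 by blast
  then have inj: "inj_on f {1..n}" and img: "f ` {1..n} = F"
    by (auto simp: bij_betw_def)
  have delta: "f i \<bullet> f j = kronecker_delta i j" if "i \<in> {1..n}" "j \<in> {1..n}" for i j
  proof -
    have "f i \<in> F" "f j \<in> F" using that img by auto
    \<comment> \<open>Orthogonality in \<open>F\<close> concerns distinct vectors; injectivity
      transfers it to distinct indices.\<close>
    moreover have "f i = f j \<longleftrightarrow> i = j" using inj that by (auto dest: inj_onD)
    ultimately show ?thesis
      using eigen_orthonormalD(2,3)[OF F(1)]
      by (auto simp: kronecker_delta_def pairwise_def orthogonal_def dot_square_norm)
  qed
  have "orthonormal_basis n f"
    using inj img ind F(2) delta by (simp add: orthonormal_basis_def)
  moreover have "\<phi> (f i) (f j) = \<phi> (f i) (f i) * kronecker_delta i j"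
    if "i \<in> {1..n}" "j \<in> {1..n}" for i j
  proof -
    have "f i \<in> F" using that img by auto
    then have "\<phi> (f i) (f j) = \<phi> (f i) (f i) * (f i \<bullet> f j)"
      by (rule eigen_orthonormalD(4)[OF F(1)])
    then show ?thesis using delta[OF that] by simp
  qed
  ultimately show ?thesis
    \<comment> \<open>The eigenvalue at a unit eigenvector is the value of the quadratic form
      there.\<close>
    by (intro exI[of _ f] exI[of _ "\<lambda>i. \<phi> (f i) (f i)"]) blast
qed

end
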